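(* Let $L>0$, let $H$ be a nonzero separable real Hilbert space, let $C\subseteq H$ be compact and convex with $D:=\operatorname{diam}(C)>0$, and let $\rho:C\to\mathbb{R}$ be convex and $L$-Lipschitz. Let $\varepsilon>0$ and set $$\delta:=\frac{\varepsilon}{4L},\qquad \alpha:=\frac{\varepsilon}{16L},\qquad \eta:=\frac{\varepsilon}{8D}.$$ Let $\{\xi_n\}_{n=1}^N\subseteq C$ be a $\delta$-net of $C$ with $N=N_\delta(C)$. Then there exist $d\in\mathbb{N}_0$, a $d$-dimensional linear subspace $V_d\subseteq H$, and an $\eta$-net $\{p_m\}_{m=1}^M$ of $V_d\cap\overline{B}_H(0,L)$ such that the map $f_{\varepsilon,d}:H\to\mathbb{R}$ defined for every $x\in H$ by $$f_{\varepsilon,d}(x):=\max_{m=1,\dots,M}\Big\{\langle p_m,x\rangle+\min_{1\le n\le N}\bigl(\rho(\xi_n)-\langle p_m,\xi_n\rangle\bigr)\Big\}$$ is convex, $L$-Lipschitz, and satisfies $$\sup_{\xi\in C}\bigl|\rho(\xi)-f_{\varepsilon,d}(\xi)\bigr|<\varepsilon.$$ Moreover, $N=N_{\varepsilon/(4L)}(C)$, $d=d_C\bigl(\tfrac{\varepsilon}{16L}\bigr)\le N_{\varepsilon/(16L)}(C)$, and $M\le\bigl(1+\tfrac{16LD}{\varepsilon}\bigr)^d$.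
   Context: $\mathbb{N}_0=\{0,1,2,\dots\}$. $\langle\cdot,\cdot\rangle$ and $\|\cdot\|$ are the inner product and norm of $H$; $B_H(x,r)$ and $\overline{B}_H(x,r)$ are the open and closed balls. "$L$-Lipschitz" means Lipschitz with constant at most $L$. $\operatorname{diam}(C)=\sup_{x,y\in C}\|x-y\|$. For $r>0$, an $r$-net of a set $S\subseteq H$ is a finite subset $S'\subseteq S$ such that every point of $S$ lies at distance at most $r$ from some point of $S'$. For a non-empty compact $C\subseteq H$ and $\delta>0$, $N_\delta(C)$ is the smallest cardinality of a subset $\mathbb{X}\subseteq C$ such that $C\subseteq\bigcup_{\xi\in\mathbb{X}}B_H(\xi,\delta)$. For a linear subspace $V\subseteq H$, $\operatorname{dist}(x,V)=\inf_{v\in V}\|x-v\|$. For $\alpha>0$, $$d_C(\alpha):=\min\Bigl\{k\in\mathbb{N}_0:\ \exists\,V_k\subseteq H\text{ linear subspace with }\dim(V_k)=k\text{ and }\sup_{\xi\in C}\operatorname{dist}(\xi,V_k)\le\alpha\Bigr\}.$$ *)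

theory Defs
  imports "HOL-Analysis.Analysis"
begin

definition is_net :: "real \<Rightarrow> 'a::metric_space set \<Rightarrow> 'a set \<Rightarrow> bool" where
  "is_net r S S' \<longleftrightarrow> finite S' \<and> S' \<subseteq> S \<and> (\<forall>x\<in>S. \<exists>y\<in>S'. dist x y \<le> r)"

(* Centres lie in C and the covering balls are open, in contrast to the
   non-strict inequality in is_net.  Finiteness is explicit because card of an
   infinite set is 0. *)
definition covering_number :: "real \<Rightarrow> 'a::metric_space set \<Rightarrow> nat" where
  "covering_number \<delta> C =
     (LEAST k. \<exists>X. finite X \<and> X \<subseteq> C \<and> card X = k \<and> C \<subseteq> (\<Union>\<xi>\<in>X. ball \<xi> \<delta>))"

(* The finite spanning set is required because dim is 0 on infinite-dimensional
   subspaces. *)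
definition subspace_of_dim :: "'a::real_vector set \<Rightarrow> nat \<Rightarrow> bool" where
  "subspace_of_dim V k \<longleftrightarrow> subspace V \<and> (\<exists>B. finite B \<and> span B = V) \<and> dim V = k"

(* infdist x V is the infimum of dist x v over v in V.  The real-valued SUP is
   meaningful for nonempty bounded C only. *)
definition approx_dim :: "'a::real_normed_vector set \<Rightarrow> real \<Rightarrow> nat" where
  "approx_dim C \<alpha> =
     (LEAST k. \<exists>V. subspace_of_dim V k \<and> (SUP \<xi>\<in>C. infdist \<xi> V) \<le> \<alpha>)"

definition max_affine ::
  "('a::real_inner \<Rightarrow> real) \<Rightarrow> nat \<Rightarrow> (nat \<Rightarrow> 'a) \<Rightarrow> nat \<Rightarrow> (nat \<Rightarrow> 'a) \<Rightarrow> 'a \<Rightarrow> real" where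
  "max_affine \<rho> N \<xi> M p x =
     (MAX m\<in>{1..M}. p m \<bullet> x + (MIN n\<in>{1..N}. \<rho> (\<xi> n) - p m \<bullet> \<xi> n))"

end

theory Submission
  imports Defs
begin

text \<open>
  Why the theorem is true. Write \<open>f\<close> for the max-affine function, so that
  \<open>f x\<close> is the maximum over \<open>m\<close> of the minimum over \<open>n\<close> of
  \<open>\<rho> (\<xi> n) + p m \<bullet> (x - \<xi> n)\<close>. As a maximum of affine functions whose slopes
  have norm at most \<open>L\<close>, it is convex and \<open>L\<close>-Lipschitz on the whole space.

  On \<open>C\<close> it cannot exceed \<open>\<rho>\<close> by much: whatever the slopes are, the inner minimum may be
  tested at a sample point \<open>\<xi> n\<close> within \<open>\<delta>\<close> of \<open>x\<close>, and there both \<open>\<rho>\<close> and the linear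
  term change by at most \<open>L * \<delta>\<close> (\<open>max_affine_upper\<close>).

  It cannot fall short by much either, provided some slope \<open>p m\<close> is nearly a subgradient of
  \<open>\<rho>\<close> at \<open>x\<close>, as tested on \<open>C\<close> (\<open>max_affine_lower\<close>). Three errors are made in producing
  such a slope.
  The first is the replacement of an exact subgradient by an approximate one of norm at most \<open>L\<close>:
  it is the gradient of the Moreau-Yosida regularisation of \<open>\<rho>\<close>, obtained by minimising \<open>\<rho>\<close>
  plus a steep quadratic penalty over the compact set \<open>C\<close> (\<open>approx_subgradient\<close>).
  The second is the orthogonal projection of that slope
  onto the finite-dimensional space \<open>V\<close>: since slopes are only paired with differences of points of \<open>C\<close>,
  which lie within \<open>2 * \<alpha>\<close> of \<open>V\<close>, the pairing changes by at most \<open>2 * L * \<alpha>\<close>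
  (\<open>inner_orth_proj_defect\<close>). The third is the move to the nearest point of the
  \<open>\<eta>\<close>-net, which changes the pairing by at most \<open>\<eta> * D\<close>.

  The net is a largest \<open>\<eta>\<close>-separated subset of the ball of radius \<open>L\<close> in \<open>V\<close>. Its size is bounded by
  comparing volumes: the balls of radius \<open>\<eta> / 2\<close> about its points are disjoint and lie in the ball of radius
  \<open>L + \<eta> / 2\<close> (\<open>packing_bound\<close>). Finally, the centres of a cover of \<open>C\<close> by \<open>\<alpha>\<close>-balls
  span a space that approximates \<open>C\<close> to within \<open>\<alpha>\<close>, which bounds the approximation dimension by the covering
  number (\<open>approx_dim_witness\<close>).
\<close>

section \<open>Volume of balls in coordinate space\<close>

text \<open>
  The dimension of \<open>V\<close> is a number and not a type, so volumes are taken with respect to the product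
  measure on functions from an orthonormal basis to the reals. The next two lemmas give this measure what
  Lebesgue measure has on a Euclidean space: translation invariance and the volume of a ball with
  arbitrary centre. A product measure is determined by its values on boxes, so translation
  invariance reduces to one dimension.
\<close>

lemma distr_PiM_lborel_translate:
  fixes a :: "'i \<Rightarrow> real"
  assumes "finite I"
  shows "distr (Pi\<^sub>M I (\<lambda>_. lborel)) (Pi\<^sub>M I (\<lambda>_. lborel)) (\<lambda>f. \<lambda>i\<in>I. a i + f i) = Pi\<^sub>M I (\<lambda>_. lborel)"
proof -
  interpret product_sigma_finite "\<lambda>_::'i. lborel :: real measure"
    by standard
  have meas: "(\<lambda>f. \<lambda>i\<in>I. a i + f i) \<in> Pi\<^sub>M I (\<lambda>_. lborel) \<rightarrow>\<^sub>M Pi\<^sub>M I (\<lambda>_. lborel)"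
    by measurable
  show ?thesis
  proof (rule PiM_eqI[OF assms])
    fix A :: "'i \<Rightarrow> real set" assume A: "\<And>i. i \<in> I \<Longrightarrow> A i \<in> sets lborel"
    have shift_sets: "(\<lambda>t. a i + t) -` A i \<in> sets lborel" if "i \<in> I" for i
      using measurable_sets[of "\<lambda>t. a i + t" borel borel "A i"] A[OF that] by simp
    have shift: "emeasure lborel ((\<lambda>t. a i + t) -` A i) = emeasure lborel (A i)" if "i \<in> I" for i
    proof -
      have "emeasure (distr lborel borel (\<lambda>t. a i + t)) (A i) = emeasure lborel ((\<lambda>t. a i + t) -` A i)"
        using A[OF that] by (subst emeasure_distr) auto
      moreover have "distr lborel borel (\<lambda>t. a i + t) = (lborel :: real measure)"
        using lborel_affine[of 1 "a i"] by (simp add: density_1)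
      ultimately show ?thesis by simp
    qed
    have "emeasure (distr (Pi\<^sub>M I (\<lambda>_. lborel)) (Pi\<^sub>M I (\<lambda>_. lborel)) (\<lambda>f. \<lambda>i\<in>I. a i + f i)) (Pi\<^sub>E I A)
        = emeasure (Pi\<^sub>M I (\<lambda>_. lborel)) ((\<lambda>f. \<lambda>i\<in>I. a i + f i) -` Pi\<^sub>E I A \<inter> space (Pi\<^sub>M I (\<lambda>_. lborel)))"
      using A assms by (intro emeasure_distr meas sets_PiM_I_finite) auto
    also have "(\<lambda>f. \<lambda>i\<in>I. a i + f i) -` Pi\<^sub>E I A \<inter> space (Pi\<^sub>M I (\<lambda>_. lborel))
        = Pi\<^sub>E I (\<lambda>i. (\<lambda>t. a i + t) -` A i)"
      by (auto simp: space_PiM PiE_def Pi_def)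
    also have "emeasure (Pi\<^sub>M I (\<lambda>_. lborel)) \<dots> = (\<Prod>i\<in>I. emeasure lborel ((\<lambda>t. a i + t) -` A i))"
      using shift_sets by (intro emeasure_PiM assms) auto
    also have "\<dots> = (\<Prod>i\<in>I. emeasure lborel (A i))"
      using shift by (intro prod.cong) auto
    finally show "emeasure (distr (Pi\<^sub>M I (\<lambda>_. lborel)) (Pi\<^sub>M I (\<lambda>_. lborel)) (\<lambda>f. \<lambda>i\<in>I. a i + f i)) (Pi\<^sub>E I A)
        = (\<Prod>i\<in>I. emeasure lborel (A i))" .
  qed simp
qed

lemma emeasure_PiM_lborel_ball:
  fixes a :: "'i \<Rightarrow> real"
  assumes "finite I" "r > 0"
  shows "emeasure (Pi\<^sub>M I (\<lambda>_. lborel)) {f \<in> space (Pi\<^sub>M I (\<lambda>_. lborel)). sqrt (\<Sum>i\<in>I. (f i - a i)\<^sup>2) \<le> r}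
       = ennreal (unit_ball_vol (real (card I)) * r ^ card I)"
proof -
  let ?M = "Pi\<^sub>M I (\<lambda>_. lborel :: real measure)"
  let ?\<tau> = "\<lambda>f. \<lambda>i\<in>I. a i + f i"
  have meas: "?\<tau> \<in> ?M \<rightarrow>\<^sub>M ?M"
    by measurable
  have "emeasure ?M {f \<in> space ?M. sqrt (\<Sum>i\<in>I. (f i - a i)\<^sup>2) \<le> r}
      = emeasure (distr ?M ?M ?\<tau>) {f \<in> space ?M. sqrt (\<Sum>i\<in>I. (f i - a i)\<^sup>2) \<le> r}"
    by (simp add: distr_PiM_lborel_translate[OF assms(1)])
  also have "\<dots> = emeasure ?M (?\<tau> -` {f \<in> space ?M. sqrt (\<Sum>i\<in>I. (f i - a i)\<^sup>2) \<le> r} \<inter> space ?M)"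
    by (intro emeasure_distr meas) measurable
  also have "?\<tau> -` {f \<in> space ?M. sqrt (\<Sum>i\<in>I. (f i - a i)\<^sup>2) \<le> r} \<inter> space ?M
      = {f. sqrt (\<Sum>i\<in>I. (f i)\<^sup>2) \<le> r} \<inter> space ?M"
    by (auto simp: space_PiM)
  also have "emeasure ?M \<dots> = ennreal (unit_ball_vol (real (card I)) * r ^ card I)"
    by (rule emeasure_cball_aux[OF assms])
  finally show ?thesis .
qed

section \<open>Orthogonal projection onto a finite-dimensional subspace\<close>

definition orthonormal :: "'a::real_inner set \<Rightarrow> bool" where
  "orthonormal E \<longleftrightarrow> pairwise orthogonal E \<and> (\<forall>e\<in>E. norm e = 1)"

lemma orthonormal_inner:
  assumes "orthonormal E" "e \<in> E" "e' \<in> E"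
  shows "e \<bullet> e' = (if e = e' then 1 else 0)"
  using assms by (auto simp: orthonormal_def pairwise_def orthogonal_def dot_square_norm)

lemma inner_orthonormal_sum:
  assumes "orthonormal E" "finite E" "e \<in> E"
  shows "(\<Sum>u\<in>E. c u *\<^sub>R u) \<bullet> e = c e"
proof -
  have "(\<Sum>u\<in>E. c u *\<^sub>R u) \<bullet> e = (\<Sum>u\<in>E. if u = e then c u else 0)"
    unfolding inner_sum_left
    by (intro sum.cong) (auto simp: orthonormal_inner[OF assms(1) _ assms(3)])
  then show ?thesis using assms by simp
qed

lemma norm_orthonormal_sum:
  assumes "orthonormal E" "finite E"
  shows "norm (\<Sum>e\<in>E. c e *\<^sub>R e) = sqrt (\<Sum>e\<in>E. (c e)\<^sup>2)"
proof -
  have "(\<Sum>e\<in>E. c e *\<^sub>R e) \<bullet> (\<Sum>e\<in>E. c e *\<^sub>R e) = (\<Sum>e\<in>E. (c e)\<^sup>2)"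
    by (subst inner_sum_right)
       (simp add: inner_orthonormal_sum[OF assms] power2_eq_square)
  then show ?thesis by (simp add: norm_eq_sqrt_inner)
qed

definition orth_proj :: "'a::real_inner set \<Rightarrow> 'a \<Rightarrow> 'a" where
  "orth_proj E x = (\<Sum>e\<in>E. (x \<bullet> e) *\<^sub>R e)"

lemma orth_proj_in_span: "orth_proj E x \<in> span E"
  unfolding orth_proj_def by (intro span_sum span_mul) (auto intro: span_base)

lemma orth_proj_residual_orthogonal:
  assumes "orthonormal E" "finite E" "v \<in> span E"
  shows "(x - orth_proj E x) \<bullet> v = 0"
  using assms(3)
proof (induction rule: span_induct_alt)
  case base then show ?case by simp
next
  case (step c e v)
  have "(x - orth_proj E x) \<bullet> e = 0"
    using step by (simp add: orth_proj_def inner_diff_left inner_orthonormal_sum[OF assms(1,2)])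
  then show ?case using step by (simp add: inner_right_distrib)
qed

lemma orth_proj_pythagoras:
  assumes "orthonormal E" "finite E" "v \<in> span E"
  shows "(norm (x - v))\<^sup>2 = (norm (x - orth_proj E x))\<^sup>2 + (norm (orth_proj E x - v))\<^sup>2"
proof -
  have "(x - orth_proj E x) \<bullet> (orth_proj E x - v) = 0"
    using assms by (intro orth_proj_residual_orthogonal span_diff orth_proj_in_span)
  then show ?thesis
    using norm_add_Pythagorean[of "x - orth_proj E x" "orth_proj E x - v"]
    by (simp add: orthogonal_def)
qed

lemma orth_proj_nearest:
  assumes "orthonormal E" "finite E" "v \<in> span E"
  shows "norm (x - orth_proj E x) \<le> norm (x - v)"
  by (rule power2_le_imp_le) (simp_all add: orth_proj_pythagoras[OF assms, of x])

lemma norm_orth_proj_le: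
  assumes "orthonormal E" "finite E"
  shows "norm (orth_proj E x) \<le> norm x"
  using orth_proj_pythagoras[OF assms span_zero, of x]
  by (intro power2_le_imp_le[OF _ norm_ge_zero]) simp

lemma orth_proj_span_eq:
  assumes "orthonormal E" "finite E" "v \<in> span E"
  shows "orth_proj E v = v"
  using orth_proj_nearest[OF assms, of v] by simp

lemma norm_orth_proj_residual_le_infdist:
  assumes "orthonormal E" "finite E"
  shows "norm (x - orth_proj E x) \<le> infdist x (span E)"
proof -
  have "span E \<noteq> {}" using span_zero by blast
  then show ?thesis
    unfolding infdist_notempty[OF \<open>span E \<noteq> {}\<close>]
    by (intro cINF_greatest) (auto simp: dist_norm orth_proj_nearest[OF assms])
qed

text \<open>
  The residual of \<open>p\<close> is orthogonal to the span, so in \<open>x - y\<close> only the residuals of \<open>x\<close> and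
  \<open>y\<close> contribute: what matters is how well the span approximates these two points, however far \<open>p\<close>
  is from it.
\<close>
lemma inner_orth_proj_defect:
  assumes E: "orthonormal E" "finite E"
    and x: "infdist x (span E) \<le> \<alpha>" and y: "infdist y (span E) \<le> \<alpha>" and p: "norm p \<le> L"
  shows "\<bar>(p - orth_proj E p) \<bullet> (x - y)\<bar> \<le> 2 * L * \<alpha>"
proof -
  let ?\<pi> = "orth_proj E"
  have "(p - ?\<pi> p) \<bullet> (x - y) = (p - ?\<pi> p) \<bullet> ((x - ?\<pi> x) - (y - ?\<pi> y))"
    using orth_proj_residual_orthogonal[OF E orth_proj_in_span] by (simp add: inner_diff_right)
  also have "\<bar>\<dots>\<bar> \<le> norm (p - ?\<pi> p) * norm ((x - ?\<pi> x) - (y - ?\<pi> y))"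
    by (rule Cauchy_Schwarz_ineq2)
  also have "\<dots> \<le> L * (2 * \<alpha>)"
  proof (rule mult_mono)
    show "norm (p - ?\<pi> p) \<le> L"
      using orth_proj_nearest[OF E span_zero, of p] p by simp
    show "norm ((x - ?\<pi> x) - (y - ?\<pi> y)) \<le> 2 * \<alpha>"
      using norm_triangle_ineq4[of "x - ?\<pi> x" "y - ?\<pi> y"] x y
        norm_orth_proj_residual_le_infdist[OF E, of x] norm_orth_proj_residual_le_infdist[OF E, of y]
      by linarith
    show "0 \<le> L" using p norm_ge_zero order_trans by blast
  qed simp
  finally show ?thesis by simp
qed

lemma finite_dim_orthonormal_basis:
  fixes V :: "'a::real_inner set"
  assumes "subspace_of_dim V d"
  obtains E where "finite E" "orthonormal E" "span E = V" "card E \<le> d"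
proof -
  obtain G where G: "finite G" "span G = V" and V: "dim V = d"
    using assms by (auto simp: subspace_of_dim_def)
  obtain B where B: "B \<subseteq> V" "independent B" "V \<subseteq> span B" "card B = dim V"
    using basis_exists by blast
  have "finite B"
    using independent_span_bound[of G B] G B by simp
  then obtain F where F: "finite F" "card F \<le> card B" "span F = span B" "pairwise orthogonal F"
    using basis_orthogonal by blast
  have "span B = V"
    using B G span_mono[of B V] by (metis span_span subset_antisym)
  \<comment> \<open>An orthogonal spanning set may contain the zero vector, which cannot be normalised.\<close>
  define E where "E = (\<lambda>x. x /\<^sub>R norm x) ` (F - {0})"
  have "pairwise orthogonal E"
    using F(4) by (auto simp: E_def pairwise_def orthogonal_def)
  then have "orthonormal E"
    by (auto simp: orthonormal_def E_def)
  moreover have "finite E" "card E \<le> d"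
    using F B V by (auto simp: E_def intro: order.trans[OF card_image_le] order.trans[OF card_Diff1_le])
  moreover have "span E = V"
  proof -
    have "span E = span (F - {0})"
      unfolding E_def using F(1) by (intro span_image_scale) auto
    then show ?thesis using F(3) \<open>span B = V\<close> by simp
  qed
  ultimately show ?thesis using that by blast
qed

section \<open>Separated sets and nets\<close>

text \<open>
  The volume comparison. The balls \<open>B x r\<close> are described through the map \<open>T\<close> from coordinates to the
  span, an isometry for the Euclidean norm on coordinates; disjointness and inclusion then follow
  from the triangle inequality in the ambient space, and the factor \<open>unit_ball_vol\<close> cancels.
\<close>
lemma packing_bound:
  assumes E: "finite E" "orthonormal E"
    and S: "finite S" "S \<subseteq> span E \<inter> cball 0 R"
    and sep: "pairwise (\<lambda>x y. dist x y > \<eta>) S" and "\<eta> > 0" "R \<ge> 0"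
  shows "real (card S) \<le> (1 + 2 * R / \<eta>) ^ card E"
proof -
  let ?M = "Pi\<^sub>M E (\<lambda>_. lborel :: real measure)"
  let ?n = "card E"
  define T where "T f = (\<Sum>e\<in>E. f e *\<^sub>R e)" for f
  define B where "B x r = {f \<in> space ?M. dist (T f) x \<le> r}" for x r
  have dist_T: "dist (T f) x = sqrt (\<Sum>e\<in>E. (f e - x \<bullet> e)\<^sup>2)" if "x \<in> span E" for x f
  proof -
    have "T f - x = (\<Sum>e\<in>E. (f e - x \<bullet> e) *\<^sub>R e)"
      using orth_proj_span_eq[OF E(2,1) that]
      by (simp add: T_def orth_proj_def sum_subtractf scaleR_left_diff_distrib)
    then show ?thesis
      by (simp add: dist_norm norm_orthonormal_sum[OF E(2,1)])
  qed
  have B_eq: "B x r = {f \<in> space ?M. sqrt (\<Sum>e\<in>E. (f e - x \<bullet> e)\<^sup>2) \<le> r}" if "x \<in> span E" for x r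
    using dist_T[OF that] by (auto simp: B_def)
  have vol_B: "emeasure ?M (B x r) = ennreal (unit_ball_vol (real ?n) * r ^ ?n)"
    if "x \<in> span E" "r > 0" for x r
    unfolding B_eq[OF that(1)] by (rule emeasure_PiM_lborel_ball[OF E(1) that(2)])
  have sets_B: "B x r \<in> sets ?M" if "x \<in> span E" for x r
    unfolding B_eq[OF that] by measurable
  have disj: "disjoint_family_on (\<lambda>x. B x (\<eta> / 2)) S"
  proof (clarsimp simp: disjoint_family_on_def)
    fix x y assume xy: "x \<in> S" "y \<in> S" "x \<noteq> y"
    have False if "f \<in> B x (\<eta> / 2)" "f \<in> B y (\<eta> / 2)" for f
      using that pairwiseD[OF sep xy] dist_triangle3[of x y "T f"] by (simp add: B_def)
    then show "B x (\<eta> / 2) \<inter> B y (\<eta> / 2) = {}" by blast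
  qed
  have incl: "(\<Union>x\<in>S. B x (\<eta> / 2)) \<subseteq> B 0 (R + \<eta> / 2)"
  proof
    fix f assume "f \<in> (\<Union>x\<in>S. B x (\<eta> / 2))"
    then obtain x where "x \<in> S" "f \<in> B x (\<eta> / 2)" by blast
    moreover have "dist x 0 \<le> R" using S \<open>x \<in> S\<close> by auto
    ultimately show "f \<in> B 0 (R + \<eta> / 2)"
      using dist_triangle[of "T f" 0 x] by (simp add: B_def)
  qed
  have "ennreal (real (card S) * (unit_ball_vol (real ?n) * (\<eta> / 2) ^ ?n))
      = (\<Sum>x\<in>S. emeasure ?M (B x (\<eta> / 2)))"
    using S \<open>\<eta> > 0\<close> vol_B
    by (subst sum.cong[OF refl, of _ _ "\<lambda>_. ennreal (unit_ball_vol (real ?n) * (\<eta> / 2) ^ ?n)"])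
       (auto simp: ennreal_mult' ennreal_of_nat_eq_real_of_nat)
  also have "\<dots> = emeasure ?M (\<Union>x\<in>S. B x (\<eta> / 2))"
    using S sets_B by (intro sum_emeasure disj) auto
  also have "\<dots> \<le> emeasure ?M (B 0 (R + \<eta> / 2))"
    by (intro emeasure_mono incl sets_B span_zero)
  also have "\<dots> = ennreal (unit_ball_vol (real ?n) * (R + \<eta> / 2) ^ ?n)"
    using \<open>\<eta> > 0\<close> \<open>R \<ge> 0\<close> by (intro vol_B span_zero) auto
  finally have "real (card S) * (unit_ball_vol (real ?n) * (\<eta> / 2) ^ ?n)
      \<le> unit_ball_vol (real ?n) * (R + \<eta> / 2) ^ ?n"
    using \<open>\<eta> > 0\<close> \<open>R \<ge> 0\<close> by (subst (asm) ennreal_le_iff) auto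
  then have "unit_ball_vol (real ?n) * (real (card S) * (\<eta> / 2) ^ ?n)
      \<le> unit_ball_vol (real ?n) * (R + \<eta> / 2) ^ ?n"
    by (simp add: mult_ac)
  then have "real (card S) * (\<eta> / 2) ^ ?n \<le> (R + \<eta> / 2) ^ ?n"
    by (simp add: mult_le_cancel_left_pos)
  then have "real (card S) \<le> (R + \<eta> / 2) ^ ?n / (\<eta> / 2) ^ ?n"
    using \<open>\<eta> > 0\<close> by (simp add: pos_le_divide_eq)
  also have "\<dots> = ((R + \<eta> / 2) / (\<eta> / 2)) ^ ?n"
    by (rule power_divide[symmetric])
  also have "(R + \<eta> / 2) / (\<eta> / 2) = 1 + 2 * R / \<eta>"
    using \<open>\<eta> > 0\<close> by (simp add: field_simps)
  finally show ?thesis .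
qed

text \<open>
  A separated set of largest cardinality is a net, since a point at distance more than \<open>\<eta>\<close> from all its
  members could be added to it. The bound on cardinalities makes a largest one exist.
\<close>
lemma bounded_packing_yields_net:
  fixes A :: "'a::metric_space set"
  assumes bound: "\<And>S. finite S \<Longrightarrow> S \<subseteq> A \<Longrightarrow> pairwise (\<lambda>x y. dist x y > \<eta>) S \<Longrightarrow> real (card S) \<le> K"
    and "\<eta> > 0"
  obtains S where "is_net \<eta> A S" "real (card S) \<le> K"
proof -
  define P where "P S \<longleftrightarrow> finite S \<and> S \<subseteq> A \<and> pairwise (\<lambda>x y. dist x y > \<eta>) S" for S
  have "P {}" by (simp add: P_def)
  have "\<forall>S. P S \<longrightarrow> card S < Suc (nat \<lfloor>K\<rfloor>)"
    using bound by (auto simp: P_def less_Suc_eq_le le_nat_floor)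
  with \<open>P {}\<close> obtain S where S: "P S" and max: "\<And>S'. P S' \<Longrightarrow> card S' \<le> card S"
    using ex_has_greatest_nat[of P "{}" card] by blast
  have "\<exists>y\<in>S. dist x y \<le> \<eta>" if "x \<in> A" for x
  proof (rule ccontr)
    assume far: "\<not> (\<exists>y\<in>S. dist x y \<le> \<eta>)"
    then have "x \<notin> S" using \<open>\<eta> > 0\<close> by force
    have "P (insert x S)"
      using S far that by (auto simp: P_def pairwise_insert dist_commute not_le)
    then show False
      using max[of "insert x S"] S \<open>x \<notin> S\<close> by (simp add: P_def)
  qed
  with S have "is_net \<eta> A S" by (simp add: P_def is_net_def)
  moreover have "real (card S) \<le> K" using S bound by (simp add: P_def)
  ultimately show ?thesis using that by blast
qed

section \<open>Approximate subgradients of bounded norm\<close>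

text \<open>
  Let \<open>z\<close> minimise \<open>\<rho> y + k / 2 * (norm (y - x))\<^sup>2\<close> over \<open>C\<close>. First-order optimality says that
  \<open>p = k (x - z)\<close> is an exact subgradient at \<open>z\<close>. Testing it at \<open>x\<close> gives
  \<open>k * (norm (x - z))\<^sup>2 \<le> \<rho> x - \<rho> z \<le> L * norm (x - z)\<close>, hence \<open>norm p \<le> L\<close>, and \<open>z\<close> is within \<open>L / k\<close>
  of \<open>x\<close>. Consequently \<open>\<rho> z\<close> is within \<open>L\<^sup>2 / k\<close> of \<open>\<rho> x\<close>, and \<open>p\<close> is a subgradient at \<open>x\<close> up to
  that error.
\<close>
lemma approx_subgradient:
  fixes C :: "'a::real_inner set"
  assumes "compact C" and cvx: "convex_on C \<rho>" and lip: "L-lipschitz_on C \<rho>"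
    and "x \<in> C" and "s > 0"
  obtains p where "norm p \<le> L" "\<And>y. y \<in> C \<Longrightarrow> \<rho> x + p \<bullet> (y - x) - s \<le> \<rho> y"
proof -
  have "L \<ge> 0" using lip by (rule lipschitz_on_nonneg)
  \<comment> \<open>Steep enough for the error \<open>L\<^sup>2 / k\<close> to be at most \<open>s\<close>; the summand 1 keeps \<open>k\<close> positive when \<open>L = 0\<close>.\<close>
  define k where "k = (L\<^sup>2 + 1) / s"
  have "k > 0" using \<open>s > 0\<close> by (simp add: k_def add_nonneg_pos)
  have Lk: "L * (L / k) \<le> s"
    using \<open>s > 0\<close> \<open>k > 0\<close> by (simp add: k_def field_simps power2_eq_square add_nonneg_pos)
  define \<psi> where "\<psi> y = \<rho> y + k / 2 * (norm (y - x))\<^sup>2" for y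
  have "continuous_on C \<psi>"
    unfolding \<psi>_def using lipschitz_on_continuous_on[OF lip] by (intro continuous_intros)
  then obtain z where z: "z \<in> C" and min: "\<And>y. y \<in> C \<Longrightarrow> \<psi> z \<le> \<psi> y"
    using continuous_attains_inf[OF \<open>compact C\<close>, of \<psi>] \<open>x \<in> C\<close> by blast
  define p where "p = k *\<^sub>R (x - z)"
  have subgrad: "\<rho> z + p \<bullet> (y - z) \<le> \<rho> y" if "y \<in> C" for y
  proof -
    \<comment> \<open>Compare \<open>z\<close> with points at parameter \<open>t\<close> on the segment to \<open>y\<close>, divide by \<open>t\<close>, and let \<open>t\<close> tend to 0.\<close>
    define q where "q = k / 2 * (norm (y - z))\<^sup>2"
    have "0 \<le> \<rho> y - \<rho> z - p \<bullet> (y - z) + t * q" if t: "0 < t" "t < 1" for t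
    proof -
      let ?w = "(1 - t) *\<^sub>R z + t *\<^sub>R y"
      have "?w \<in> C"
        using convex_on_imp_convex[OF cvx] z \<open>y \<in> C\<close> t by (simp add: convex_alt)
      have w: "?w - x = (z - x) + t *\<^sub>R (y - z)" by (simp add: algebra_simps)
      have "\<psi> z \<le> \<psi> ?w" by (rule min[OF \<open>?w \<in> C\<close>])
      also have "\<dots> \<le> (1 - t) * \<rho> z + t * \<rho> y + k / 2 * (norm (?w - x))\<^sup>2"
        unfolding \<psi>_def using convex_onD[OF cvx, of t z y] z \<open>y \<in> C\<close> t by simp
      also have "(norm (?w - x))\<^sup>2
          = (norm (z - x))\<^sup>2 + 2 * t * ((z - x) \<bullet> (y - z)) + t\<^sup>2 * (norm (y - z))\<^sup>2"
        unfolding w power2_norm_eq_inner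
        by (simp add: inner_simps inner_commute power2_eq_square algebra_simps)
      finally have "0 \<le> t * (\<rho> y - \<rho> z - p \<bullet> (y - z) + t * q)"
        by (simp add: \<psi>_def p_def q_def algebra_simps power2_eq_square inner_diff_left)
      then show ?thesis using t by (simp add: zero_le_mult_iff)
    qed
    then have "\<forall>\<^sub>F t in at_right 0. 0 \<le> \<rho> y - \<rho> z - p \<bullet> (y - z) + t * q"
      unfolding eventually_at_right_field by (intro exI[of _ 1]) auto
    moreover have "((\<lambda>t. \<rho> y - \<rho> z - p \<bullet> (y - z) + t * q) \<longlongrightarrow> \<rho> y - \<rho> z - p \<bullet> (y - z) + 0 * q) (at_right 0)"
      by (intro tendsto_intros)
    ultimately have "0 \<le> \<rho> y - \<rho> z - p \<bullet> (y - z) + 0 * q"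
      by (intro tendsto_lowerbound) auto
    then show ?thesis by simp
  qed
  let ?r = "norm (x - z)"
  have lipz: "\<rho> x - \<rho> z \<le> L * ?r"
    using lipschitz_onD[OF lip \<open>x \<in> C\<close> z] by (simp add: dist_norm)
  have pr: "p \<bullet> (x - z) = k * ?r\<^sup>2" by (simp add: p_def power2_norm_eq_inner)
  have "k * ?r * ?r \<le> L * ?r"
    using subgrad[OF \<open>x \<in> C\<close>] lipz pr by (simp add: power2_eq_square mult_ac)
  then have kr: "k * ?r \<le> L" using \<open>L \<ge> 0\<close> by (cases "?r = 0") (simp_all add: mult_le_cancel_right)
  then have "norm p \<le> L" using \<open>k > 0\<close> by (simp add: p_def)
  moreover have "\<rho> x + p \<bullet> (y - x) - s \<le> \<rho> y" if "y \<in> C" for y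
  proof -
    have "L * ?r \<le> L * (L / k)"
      using kr \<open>k > 0\<close> \<open>L \<ge> 0\<close> by (intro mult_left_mono) (simp_all add: field_simps)
    then have "\<rho> x - \<rho> z \<le> s" using lipz Lk by linarith
    moreover have "p \<bullet> (y - z) = p \<bullet> (y - x) + p \<bullet> (x - z)" by (simp add: inner_diff_right)
    moreover have "0 \<le> p \<bullet> (x - z)" using pr \<open>k > 0\<close> by simp
    ultimately show ?thesis using subgrad[OF that] by linarith
  qed
  ultimately show ?thesis using that by blast
qed

section \<open>Maxima of affine functions\<close>

lemma convex_on_Max_image:
  assumes "finite I" "I \<noteq> {}" "\<And>i. i \<in> I \<Longrightarrow> convex_on S (f i)" "convex S"
  shows "convex_on S (\<lambda>x. MAX i\<in>I. f i x)"
proof (rule convex_onI)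
  fix t :: real and x y
  assume t: "0 < t" "t < 1" and xy: "x \<in> S" "y \<in> S"
  have "f i ((1 - t) *\<^sub>R x + t *\<^sub>R y) \<le> (1 - t) * (MAX i\<in>I. f i x) + t * (MAX i\<in>I. f i y)"
    if "i \<in> I" for i
  proof -
    have "f i ((1 - t) *\<^sub>R x + t *\<^sub>R y) \<le> (1 - t) * f i x + t * f i y"
      using convex_onD[OF assms(3)[OF that]] t xy by simp
    also have "\<dots> \<le> (1 - t) * (MAX i\<in>I. f i x) + t * (MAX i\<in>I. f i y)"
      using assms(1) that t by (intro add_mono mult_left_mono Max_ge) auto
    finally show ?thesis .
  qed
  then show "(MAX i\<in>I. f i ((1 - t) *\<^sub>R x + t *\<^sub>R y))
      \<le> (1 - t) * (MAX i\<in>I. f i x) + t * (MAX i\<in>I. f i y)"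
    using assms(1,2) by (subst Max_le_iff) auto
qed fact

lemma lipschitz_on_Max_image:
  fixes f :: "'i \<Rightarrow> 'a::metric_space \<Rightarrow> real"
  assumes "finite I" "I \<noteq> {}" "\<And>i. i \<in> I \<Longrightarrow> L-lipschitz_on S (f i)"
  shows "L-lipschitz_on S (\<lambda>x. MAX i\<in>I. f i x)"
proof (rule lipschitz_onI)
  have le: "(MAX i\<in>I. f i x) \<le> (MAX i\<in>I. f i y) + L * dist x y" if "x \<in> S" "y \<in> S" for x y
  proof -
    have "f i x \<le> (MAX i\<in>I. f i y) + L * dist x y" if "i \<in> I" for i
    proof -
      have "f i x \<le> f i y + L * dist x y"
        using lipschitz_onD[OF assms(3)[OF that] \<open>x \<in> S\<close> \<open>y \<in> S\<close>] by (simp add: dist_real_def)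
      also have "f i y \<le> (MAX i\<in>I. f i y)" using assms(1) that by (intro Max_ge) auto
      finally show ?thesis by simp
    qed
    then show ?thesis using assms(1,2) by (subst Max_le_iff) auto
  qed
  show "dist (MAX i\<in>I. f i x) (MAX i\<in>I. f i y) \<le> L * dist x y" if "x \<in> S" "y \<in> S" for x y
    using le[OF that] le[OF that(2,1)] by (simp add: dist_real_def dist_commute abs_le_iff)
  show "0 \<le> L" using assms(2,3) lipschitz_on_nonneg by blast
qed

lemma convex_on_affine_functional: "convex_on UNIV (\<lambda>x::'a::real_inner. p \<bullet> x + c)"
  by (rule convex_onI) (simp_all add: inner_right_distrib algebra_simps)

lemma lipschitz_on_affine_functional:
  fixes p :: "'a::real_inner"
  assumes "norm p \<le> L"
  shows "L-lipschitz_on UNIV (\<lambda>x. p \<bullet> x + c)"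
proof (rule lipschitz_onI)
  fix x y
  have "\<bar>p \<bullet> (x - y)\<bar> \<le> norm p * norm (x - y)" by (rule Cauchy_Schwarz_ineq2)
  also have "\<dots> \<le> L * norm (x - y)" using assms by (intro mult_right_mono) auto
  finally show "dist (p \<bullet> x + c) (p \<bullet> y + c) \<le> L * dist x y"
    by (simp add: dist_norm inner_diff_right)
next
  show "0 \<le> L" using assms norm_ge_zero order_trans by blast
qed

text \<open>
  For every slope the inner minimum is at most its value at a sample point near \<open>x\<close>. One summand \<open>L * \<delta>\<close>
  is the variation of \<open>\<rho>\<close> between the two points, the other that of the linear term.
\<close>
lemma max_affine_upper:
  fixes C :: "'a::real_inner set"
  assumes lip: "L-lipschitz_on C \<rho>" and net: "is_net \<delta> C (\<xi> ` {1..N})"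
    and "M \<ge> 1" and p: "\<And>m. m \<in> {1..M} \<Longrightarrow> norm (p m) \<le> L" and "x \<in> C"
  shows "max_affine \<rho> N \<xi> M p x \<le> \<rho> x + 2 * L * \<delta>"
proof -
  have "L \<ge> 0" using lip by (rule lipschitz_on_nonneg)
  obtain n where n: "n \<in> {1..N}" "\<xi> n \<in> C" "dist x (\<xi> n) \<le> \<delta>"
    using net \<open>x \<in> C\<close> by (fastforce simp: is_net_def)
  have "p m \<bullet> x + (MIN n\<in>{1..N}. \<rho> (\<xi> n) - p m \<bullet> \<xi> n) \<le> \<rho> x + 2 * L * \<delta>" if "m \<in> {1..M}" for m
  proof -
    have "(MIN n\<in>{1..N}. \<rho> (\<xi> n) - p m \<bullet> \<xi> n) \<le> \<rho> (\<xi> n) - p m \<bullet> \<xi> n"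
      using n(1) by (intro Min_le) auto
    moreover have "\<rho> (\<xi> n) \<le> \<rho> x + L * \<delta>"
      using lipschitz_onD[OF lip n(2) \<open>x \<in> C\<close>] mult_left_mono[OF n(3) \<open>L \<ge> 0\<close>]
      by (simp add: dist_real_def dist_commute)
    moreover have "p m \<bullet> (x - \<xi> n) \<le> L * \<delta>"
    proof -
      have "p m \<bullet> (x - \<xi> n) \<le> norm (p m) * norm (x - \<xi> n)" by (rule norm_cauchy_schwarz)
      also have "\<dots> \<le> L * \<delta>" using p[OF that] n(3) \<open>L \<ge> 0\<close> by (intro mult_mono) (auto simp: dist_norm)
      finally show ?thesis .
    qed
    ultimately show ?thesis by (simp add: inner_diff_right)
  qed
  then show ?thesis
    unfolding max_affine_def using \<open>M \<ge> 1\<close> by (subst Max_le_iff) auto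
qed

text \<open>
  A single slope that supports the sampled values of \<open>\<rho>\<close> from \<open>x\<close> up to \<open>s\<close> suffices, because the outer
  operation is a maximum.
\<close>
lemma max_affine_lower:
  fixes x :: "'a::real_inner"
  assumes "N \<ge> 1" and "m \<in> {1..M}"
    and supp: "\<And>n. n \<in> {1..N} \<Longrightarrow> \<rho> x + p m \<bullet> (\<xi> n - x) - s \<le> \<rho> (\<xi> n)"
  shows "\<rho> x - s \<le> max_affine \<rho> N \<xi> M p x"
proof -
  have "\<rho> x - s - p m \<bullet> x \<le> (MIN n\<in>{1..N}. \<rho> (\<xi> n) - p m \<bullet> \<xi> n)"
    using supp \<open>N \<ge> 1\<close> by (subst Min_ge_iff) (auto simp: inner_diff_right algebra_simps)
  also have "\<dots> + p m \<bullet> x \<le> max_affine \<rho> N \<xi> M p x"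
    unfolding max_affine_def using assms(2) by (subst add.commute) (intro Max_ge, auto)
  finally show ?thesis by simp
qed

section \<open>Approximation dimension and covering number\<close>

lemma covering_number_attained:
  assumes "compact C" "\<delta> > 0"
  obtains X where "finite X" "X \<subseteq> C" "card X = covering_number \<delta> C" "C \<subseteq> (\<Union>x\<in>X. ball x \<delta>)"
proof -
  let ?P = "\<lambda>k. \<exists>X. finite X \<and> X \<subseteq> C \<and> card X = k \<and> C \<subseteq> (\<Union>x\<in>X. ball x \<delta>)"
  obtain Y where "finite Y" "Y \<subseteq> C" "C \<subseteq> (\<Union>x\<in>Y. ball x \<delta>)"
  proof (rule compactE_image[OF \<open>compact C\<close>, of C "\<lambda>x. ball x \<delta>"])
    show "C \<subseteq> (\<Union>x\<in>C. ball x \<delta>)" using \<open>\<delta> > 0\<close> by force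
  qed auto
  then have "?P (card Y)" by (intro exI[of _ Y] conjI refl)
  then have "?P (covering_number \<delta> C)"
    unfolding covering_number_def by (rule LeastI)
  then show ?thesis by (elim exE conjE) (rule that)
qed

text \<open>
  The span of the centres of an optimal \<open>\<alpha>\<close>-cover is a competitor in the minimum that defines
  \<open>approx_dim\<close>. It gives the bound and also shows that the minimum is attained, so that an optimal \<open>V\<close> exists.
\<close>
lemma approx_dim_witness:
  fixes C :: "'a::real_normed_vector set"
  assumes "compact C" "C \<noteq> {}" "\<alpha> > 0"
  shows "\<exists>V. subspace_of_dim V (approx_dim C \<alpha>) \<and> (\<forall>x\<in>C. infdist x V \<le> \<alpha>)"
    and "approx_dim C \<alpha> \<le> covering_number \<alpha> C"
proof -
  let ?P = "\<lambda>k. \<exists>V::'a set. subspace_of_dim V k \<and> (SUP x\<in>C. infdist x V) \<le> \<alpha>"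
  obtain X where X: "finite X" "card X = covering_number \<alpha> C" "C \<subseteq> (\<Union>x\<in>X. ball x \<alpha>)"
    by (rule covering_number_attained[OF assms(1,3)])
  have "(SUP x\<in>C. infdist x (span X)) \<le> \<alpha>"
  proof (rule cSUP_least[OF \<open>C \<noteq> {}\<close>])
    fix x assume "x \<in> C"
    then obtain c where c: "c \<in> X" "dist c x < \<alpha>" using X(3) by auto
    then show "infdist x (span X) \<le> \<alpha>"
      by (intro infdist_le2[of c]) (auto simp: span_base dist_commute)
  qed
  then have P: "?P (dim X)"
    using X(1) by (intro exI[of _ "span X"]) (auto simp: subspace_of_dim_def)
  then have "approx_dim C \<alpha> \<le> dim X"
    unfolding approx_dim_def by (rule Least_le)
  also have "dim X \<le> card X" using X(1) by (rule dim_le_card')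
  finally show "approx_dim C \<alpha> \<le> covering_number \<alpha> C" using X(2) by simp
  have "?P (approx_dim C \<alpha>)"
    unfolding approx_dim_def using P by (rule LeastI)
  then obtain V where V: "subspace_of_dim V (approx_dim C \<alpha>)" "(SUP x\<in>C. infdist x V) \<le> \<alpha>"
    by blast
  have "0 \<in> V" using V(1) by (auto simp: subspace_of_dim_def subspace_0)
  obtain b where b: "\<And>x. x \<in> C \<Longrightarrow> norm x \<le> b"
    using compact_imp_bounded[OF \<open>compact C\<close>] by (auto simp: bounded_iff)
  \<comment> \<open>A real supremum bounds the individual distances only if they are bounded above.\<close>
  have "bdd_above ((\<lambda>x. infdist x V) ` C)"
    using infdist_le[OF \<open>0 \<in> V\<close>] b by (intro bdd_aboveI2[of _ _ b]) (force intro: order_trans)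
  then have "infdist x V \<le> \<alpha>" if "x \<in> C" for x
    using cSUP_upper[OF that] V(2) by (meson order_trans)
  with V(1) show "\<exists>V. subspace_of_dim V (approx_dim C \<alpha>) \<and> (\<forall>x\<in>C. infdist x V \<le> \<alpha>)" by blast
qed

section \<open>The approximation theorem\<close>

theorem theorem3p1:
  fixes C :: "'a::{real_inner, complete_space} set"
    and \<rho> :: "'a \<Rightarrow> real"
    and \<xi> :: "nat \<Rightarrow> 'a"
    and N :: nat
    and L D \<epsilon> \<delta> \<alpha> \<eta> :: real
  assumes L_pos: "L > 0"
    and nonzero: "\<exists>x::'a. x \<noteq> 0"
    and separable: "separable_space (euclidean :: 'a topology)"
    and compact: "compact C"
    and convex: "convex C"
    and D_def: "D = diameter C"
    and D_pos: "D > 0"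
    and \<rho>_convex: "convex_on C \<rho>"
    and \<rho>_lipschitz: "L-lipschitz_on C \<rho>"
    and \<epsilon>_pos: "\<epsilon> > 0"
    and \<delta>_def: "\<delta> = \<epsilon> / (4 * L)"
    and \<alpha>_def: "\<alpha> = \<epsilon> / (16 * L)"
    and \<eta>_def: "\<eta> = \<epsilon> / (8 * D)"
    and \<xi>_net: "is_net \<delta> C (\<xi> ` {1..N})"
    and N_def: "N = covering_number \<delta> C"
  shows "\<exists>(d::nat) (V::'a set) (M::nat) (p::nat \<Rightarrow> 'a).
           subspace_of_dim V d \<and>
           is_net \<eta> (V \<inter> cball 0 L) (p ` {1..M}) \<and> inj_on p {1..M} \<and>
           convex_on UNIV (max_affine \<rho> N \<xi> M p) \<and>
           L-lipschitz_on UNIV (max_affine \<rho> N \<xi> M p) \<and>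
           (SUP x\<in>C. \<bar>\<rho> x - max_affine \<rho> N \<xi> M p x\<bar>) < \<epsilon> \<and>
           N = covering_number (\<epsilon> / (4 * L)) C \<and>
           d = approx_dim C (\<epsilon> / (16 * L)) \<and>
           approx_dim C (\<epsilon> / (16 * L)) \<le> covering_number (\<epsilon> / (16 * L)) C \<and>
           real M \<le> (1 + 16 * L * D / \<epsilon>) ^ d"
proof -
  let ?d = "approx_dim C \<alpha>"
  have "C \<noteq> {}" using D_pos D_def by auto
  have pos: "\<delta> > 0" "\<alpha> > 0" "\<eta> > 0"
    using L_pos \<epsilon>_pos D_pos by (auto simp: \<delta>_def \<alpha>_def \<eta>_def)
  have dist_C: "norm (x - y) \<le> D" if "x \<in> C" "y \<in> C" for x y
    using diameter_bounded_bound[OF compact_imp_bounded[OF compact] that] by (simp add: D_def dist_norm)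
  have \<xi>_C: "\<xi> n \<in> C" if "n \<in> {1..N}" for n
    using \<xi>_net that by (auto simp: is_net_def)
  have "N \<ge> 1"
    using \<xi>_net \<open>C \<noteq> {}\<close> by (fastforce simp: is_net_def)
  obtain V where V: "subspace_of_dim V ?d" and V_near: "\<And>x. x \<in> C \<Longrightarrow> infdist x V \<le> \<alpha>"
    using approx_dim_witness(1)[OF compact \<open>C \<noteq> {}\<close> pos(2)] by blast
  obtain E where E: "finite E" "orthonormal E" "span E = V" "card E \<le> ?d"
    using finite_dim_orthonormal_basis[OF V] by blast
  obtain S where S: "is_net \<eta> (V \<inter> cball 0 L) S"
    and card_S: "real (card S) \<le> (1 + 2 * L / \<eta>) ^ card E"
  proof (rule bounded_packing_yields_net)
    fix S assume "finite S" "S \<subseteq> V \<inter> cball 0 L" "pairwise (\<lambda>x y. \<eta> < dist x y) S"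
    then show "real (card S) \<le> (1 + 2 * L / \<eta>) ^ card E"
      using packing_bound[OF E(1,2), of S L \<eta>] E(3) pos(3) L_pos by simp
  qed (use pos in auto)
  define M where "M = card S"
  obtain p where p: "bij_betw p {1..M} S"
    using ex_bij_betw_nat_finite_1[of S] S by (auto simp: is_net_def M_def)
  have p_img: "p ` {1..M} = S" using p by (rule bij_betw_imp_surj_on)
  have p_norm: "norm (p m) \<le> L" if "m \<in> {1..M}" for m
    using S p_img that by (force simp: is_net_def)
  have "0 \<in> V \<inter> cball 0 L" using E(3) span_zero L_pos by auto
  then have "S \<noteq> {}" using S by (auto simp: is_net_def)
  then have "M \<ge> 1" using p_img by (cases M) auto
  let ?f = "max_affine \<rho> N \<xi> M p"
  have f_convex: "convex_on UNIV ?f"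
    unfolding max_affine_def[abs_def] using \<open>M \<ge> 1\<close>
    by (intro convex_on_Max_image convex_on_affine_functional) auto
  have f_lipschitz: "L-lipschitz_on UNIV ?f"
    unfolding max_affine_def[abs_def] using \<open>M \<ge> 1\<close> p_norm
    by (intro lipschitz_on_Max_image lipschitz_on_affine_functional) auto
  let ?\<pi> = "orth_proj E"
  have f_upper: "?f x \<le> \<rho> x + \<epsilon> / 2" if "x \<in> C" for x
    using max_affine_upper[OF \<rho>_lipschitz \<xi>_net \<open>M \<ge> 1\<close> p_norm that] L_pos by (simp add: \<delta>_def)
  \<comment> \<open>The loss of \<open>\<epsilon> / 2\<close> is \<open>\<epsilon> / 4\<close> for the approximate subgradient, \<open>\<epsilon> / 8\<close> for its projection
    onto \<open>V\<close>, and \<open>\<epsilon> / 8\<close> for the step to the net.\<close>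
  have f_lower: "\<rho> x - \<epsilon> / 2 \<le> ?f x" if "x \<in> C" for x
  proof -
    obtain g where g: "norm g \<le> L" "\<And>y. y \<in> C \<Longrightarrow> \<rho> x + g \<bullet> (y - x) - \<epsilon> / 4 \<le> \<rho> y"
      using approx_subgradient[OF compact \<rho>_convex \<rho>_lipschitz \<open>x \<in> C\<close>, of "\<epsilon> / 4"] \<epsilon>_pos by auto
    have "?\<pi> g \<in> V \<inter> cball 0 L"
      using orth_proj_in_span[of E g] norm_orth_proj_le[OF E(2,1), of g] g(1) E(3) by auto
    then obtain m where m: "m \<in> {1..M}" "dist (?\<pi> g) (p m) \<le> \<eta>"
      using S p_img unfolding is_net_def by blast
    have "\<rho> x + p m \<bullet> (\<xi> n - x) - \<epsilon> / 2 \<le> \<rho> (\<xi> n)" if "n \<in> {1..N}" for n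
    proof -
      note \<xi>_C[OF that]
      have "\<bar>(g - ?\<pi> g) \<bullet> (\<xi> n - x)\<bar> \<le> 2 * L * \<alpha>"
        using V_near \<open>\<xi> n \<in> C\<close> \<open>x \<in> C\<close> E(3)
        by (intro inner_orth_proj_defect E g(1)) auto
      then have "\<bar>(g - ?\<pi> g) \<bullet> (\<xi> n - x)\<bar> \<le> \<epsilon> / 8"
        using L_pos by (simp add: \<alpha>_def)
      moreover have "\<bar>(p m - ?\<pi> g) \<bullet> (\<xi> n - x)\<bar> \<le> \<epsilon> / 8"
      proof -
        have "\<bar>(p m - ?\<pi> g) \<bullet> (\<xi> n - x)\<bar> \<le> norm (p m - ?\<pi> g) * norm (\<xi> n - x)"
          by (rule Cauchy_Schwarz_ineq2)
        also have "\<dots> \<le> \<eta> * D"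
          using m(2) dist_C[OF \<open>\<xi> n \<in> C\<close> \<open>x \<in> C\<close>] pos
          by (intro mult_mono) (auto simp: dist_norm norm_minus_commute)
        finally show ?thesis using D_pos by (simp add: \<eta>_def)
      qed
      moreover have "p m \<bullet> (\<xi> n - x) = g \<bullet> (\<xi> n - x) - (g - ?\<pi> g) \<bullet> (\<xi> n - x) + (p m - ?\<pi> g) \<bullet> (\<xi> n - x)"
        by (simp add: inner_diff_left)
      ultimately show ?thesis using g(2)[OF \<open>\<xi> n \<in> C\<close>] by linarith
    qed
    then show ?thesis by (rule max_affine_lower[OF \<open>N \<ge> 1\<close> m(1)])
  qed
  have "\<bar>\<rho> x - ?f x\<bar> \<le> \<epsilon> / 2" if "x \<in> C" for x
    using f_upper[OF that] f_lower[OF that] by linarith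
  then have "(SUP x\<in>C. \<bar>\<rho> x - ?f x\<bar>) \<le> \<epsilon> / 2"
    by (rule cSUP_least[OF \<open>C \<noteq> {}\<close>])
  then have sup: "(SUP x\<in>C. \<bar>\<rho> x - ?f x\<bar>) < \<epsilon>" using \<epsilon>_pos by linarith
  have "real M \<le> (1 + 2 * L / \<eta>) ^ card E" using card_S by (simp add: M_def)
  also have "\<dots> \<le> (1 + 2 * L / \<eta>) ^ ?d"
    using E(4) L_pos pos by (intro power_increasing) auto
  also have "2 * L / \<eta> = 16 * L * D / \<epsilon>" using D_pos \<epsilon>_pos by (simp add: \<eta>_def field_simps)
  finally have M_le: "real M \<le> (1 + 16 * L * D / \<epsilon>) ^ ?d" .
  show ?thesis
    using V S p_img bij_betw_imp_inj_on[OF p] f_convex f_lipschitz sup M_le N_def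
      approx_dim_witness(2)[OF compact \<open>C \<noteq> {}\<close> pos(2)]
    by (intro exI[of _ ?d] exI[of _ V] exI[of _ M] exI[of _ p]) (simp add: \<delta>_def \<alpha>_def)
qed

end
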